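(* Let $(X,\rho,\mathfrak m)$ be a compact $d$-Ahlfors regular metric measure space, $d>0$, of diameter at most $1$. Let $\gamma_d:=1+\sqrt d$. Then the map $([-1,1]\times X\times[0,1])^N\to C(X)$, $\theta\mapsto\hat f_\theta$, is $\gamma_d$-Lipschitz, and there are constants $0<c_d'\le C_d<\infty$, depending only on $(X,\rho,\mathfrak m)$, such that for every integer $N\ge 2$ there are points $x_1,\dots,x_N\in X$ for which $$c_d'\,N^{-1/d}\,(\log_2 N)^{-1/d}\ \le\ d^{\gamma_d}_{N}(\mathcal F_{1:d})_{C(X)}\ \le\ \sup_{f\in\mathcal F_{1:d}}\|f-\hat f_{\theta_f}\|_{C(X)}\ \le\ C_d\,N^{-1/d},$$ where $\theta_f:=((f(x_n),x_n,1))_{n=1}^N$.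
   Context: A metric measure space $(X,\rho,\mathfrak m)$ is $d$-Ahlfors regular if $\operatorname{supp}(\mathfrak m)=X$ and there are constants $0<c_A\le C_A<\infty$ with $c_A r^d\le\mathfrak m(B(x,r))\le C_A r^d$ for every $x\in X$ and $0<r\le\operatorname{diam}(X)$. Metric spaces are assumed non-empty. $\mathcal F_{1:d}$ is the set of all $1$-Lipschitz functions $f:X\to[-1,1]$; $C(X)$ carries the sup norm. For $\theta=((a_m,b_m,c_m))_{m=1}^N\in(\mathbb R\times X\times[0,\infty))^N$, $$\hat f_\theta(x):=\tfrac12\Big(\min_{1\le m\le N}\big(a_m+c_m\rho(x,b_m)\big)+\max_{1\le m\le N}\big(a_m-c_m\rho(x,b_m)\big)\Big),\quad x\in X.$$ The parameter space is equipped with the $\ell^1$-product metric $\sum_{m=1}^N\big(|a_m-\tilde a_m|+\rho(b_m,\tilde b_m)+|c_m-\tilde c_m|\big)$. Lipschitz width: for a Banach space $\mathcal X$, a bounded set $\mathcal K\subseteq\mathcal X$, $n\in\mathbb N_+$ and $\gamma\ge0$, $$d_n^\gamma(\mathcal K)_{\mathcal X}:=\inf_{\|\cdot\|_{Y_n}}\ \inf_{\Phi}\ \sup_{f\in\mathcal K}\ \inf_{y\in B_{Y_n}}\|f-\Phi(y)\|_{\mathcal X},$$ where the first infimum is over all norms $\|\cdot\|_{Y_n}$ on $\mathbb R^n$, $B_{Y_n}$ is the closed unit ball of $(\mathbb R^n,\|\cdot\|_{Y_n})$, and the second infimum is over all $\gamma$-Lipschitz maps $\Phi:(B_{Y_n},\|\cdot\|_{Y_n})\to\mathcal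 X$.
   Formalization: The space X is additionally assumed to have at least two points; for a one-point space Ahlfors regularity is vacuous, the Lipschitz width is 0, and the positive lower bound fails. *)

theory Defs
  imports "HOL-Analysis.Analysis"
begin

section \<open>Ahlfors regular metric measure spaces\<close>

text \<open>The metric space is the whole type \<^typ>\<open>'a\<close>, and the measure lives on its Borel
  sets.\<close>

definition measure_support :: "'a::topological_space measure \<Rightarrow> 'a set" where
  "measure_support M = {x. \<forall>U. open U \<and> x \<in> U \<longrightarrow> emeasure M U > 0}"

text \<open>The library value of \<^const>\<open>diameter\<close> is meaningful for bounded sets only; in an
  unbounded space the diameter is infinite and the radius is unrestricted.
  On a one-point space the growth condition is vacuous (no \<open>r\<close> satisfies \<open>0 < r \<le> 0\<close>), so
  such a space with any positive mass is regular for every \<open>d\<close>; there the width of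
  \<open>lip_class\<close> below is \<open>0\<close>, and no positive lower bound for it can hold.\<close>

definition ahlfors_regular :: "real \<Rightarrow> 'a::metric_space measure \<Rightarrow> bool" where
  "ahlfors_regular d M \<longleftrightarrow>
     sets M = sets borel \<and>
     measure_support M = UNIV \<and>
     (\<exists>cA CA::real. 0 < cA \<and> cA \<le> CA \<and>
       (\<forall>(x::'a) r. 0 < r \<and> (bounded (UNIV::'a set) \<longrightarrow> r \<le> diameter (UNIV::'a set)) \<longrightarrow>
          ennreal (cA * r powr d) \<le> emeasure M (ball x r) \<and>
          emeasure M (ball x r) \<le> ennreal (CA * r powr d)))"

section \<open>The function class and the approximants\<close>

definition lip_class :: "('a::metric_space \<Rightarrow>\<^sub>C real) set" where
  "lip_class = {f. 1-lipschitz_on UNIV (apply_bcontfun f) \<and> range (apply_bcontfun f) \<subseteq> {-1..1}}"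

text \<open>A parameter tuple of length \<open>N\<close> is a function on the index set \<open>{1..N}\<close>.\<close>

type_synonym 'a params = "nat \<Rightarrow> real \<times> 'a \<times> real"

definition f_hat_fun :: "nat \<Rightarrow> 'a::metric_space params \<Rightarrow> 'a \<Rightarrow> real" where
  "f_hat_fun N \<theta> x = 1 / 2 *
     ((MIN m\<in>{1..N}. case \<theta> m of (a, b, c) \<Rightarrow> a + c * dist x b) +
      (MAX m\<in>{1..N}. case \<theta> m of (a, b, c) \<Rightarrow> a - c * dist x b))"

text \<open>The same function as an element of \<open>C(X)\<close>; this is meaningful when \<open>X\<close> is compact, see
  \<open>apply_f_hat\<close> below.\<close>

definition f_hat :: "nat \<Rightarrow> 'a::metric_space params \<Rightarrow> 'a \<Rightarrow>\<^sub>C real" where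
  "f_hat N \<theta> = Bcontfun (f_hat_fun N \<theta>)"

definition param_space :: "nat \<Rightarrow> 'a params set" where
  "param_space N = {1..N} \<rightarrow>\<^sub>E ({-1..1} \<times> UNIV \<times> {0..1})"

definition param_dist :: "nat \<Rightarrow> 'a::metric_space params \<Rightarrow> 'a params \<Rightarrow> real" where
  "param_dist N \<theta> \<theta>' = (\<Sum>m=1..N. case (\<theta> m, \<theta>' m) of
     ((a, b, c), (a', b', c')) \<Rightarrow> \<bar>a - a'\<bar> + dist b b' + \<bar>c - c'\<bar>)"

definition theta_of :: "nat \<Rightarrow> (nat \<Rightarrow> 'a) \<Rightarrow> ('a::metric_space \<Rightarrow>\<^sub>C real) \<Rightarrow> 'a params" where
  "theta_of N p f = (\<lambda>n\<in>{1..N}. (apply_bcontfun f (p n), p n, 1))"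

lemma continuous_on_MIN_MAX:
  fixes g :: "nat \<Rightarrow> 'a::topological_space \<Rightarrow> real"
  assumes "finite I" and "\<And>m. m \<in> I \<Longrightarrow> continuous_on S (g m)"
  shows "continuous_on S (\<lambda>x. MIN m\<in>I. g m x)" and "continuous_on S (\<lambda>x. MAX m\<in>I. g m x)"
proof -
  have "continuous_on S (\<lambda>x. MIN m\<in>I. g m x) \<and> continuous_on S (\<lambda>x. MAX m\<in>I. g m x)"
    using assms
  proof (induction I rule: finite_induct)
    case (insert i I)
    then show ?case
      by (cases "I = {}") (auto intro!: continuous_on_min continuous_on_max)
  qed simp
  then show "continuous_on S (\<lambda>x. MIN m\<in>I. g m x)" "continuous_on S (\<lambda>x. MAX m\<in>I. g m x)"
    by auto
qed

lemma apply_f_hat: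
  assumes "compact (UNIV :: 'a::metric_space set)"
  shows "apply_bcontfun (f_hat N \<theta>) (x::'a) = f_hat_fun N \<theta> x"
proof -
  have "continuous_on UNIV (f_hat_fun N \<theta>)"
    unfolding f_hat_fun_def case_prod_beta
    by (intro continuous_intros continuous_on_MIN_MAX) auto
  moreover have "bounded (range (f_hat_fun N \<theta>))"
    using compact_continuous_image[OF calculation assms] by (rule compact_imp_bounded)
  ultimately show ?thesis
    by (simp add: f_hat_def Bcontfun_inverse bcontfun_def)
qed

instance bcontfun :: (metric_space, banach) banach ..

section \<open>Lipschitz width\<close>

text \<open>The dimension \<open>n\<close> is a term here, so \<open>\<real>\<^sup>n\<close> is the space of real sequences supported on
  \<open>{1..n}\<close>, with pointwise operations.\<close>

definition Rn :: "nat \<Rightarrow> (nat \<Rightarrow> real) set" where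
  "Rn n = {y. \<forall>i. i \<notin> {1..n} \<longrightarrow> y i = 0}"

definition norm_on_Rn :: "nat \<Rightarrow> ((nat \<Rightarrow> real) \<Rightarrow> real) \<Rightarrow> bool" where
  "norm_on_Rn n Y \<longleftrightarrow>
     (\<forall>y\<in>Rn n. 0 \<le> Y y) \<and>
     (\<forall>y\<in>Rn n. Y y = 0 \<longleftrightarrow> (\<forall>i. y i = 0)) \<and>
     (\<forall>t. \<forall>y\<in>Rn n. Y (\<lambda>i. t * y i) = \<bar>t\<bar> * Y y) \<and>
     (\<forall>y\<in>Rn n. \<forall>z\<in>Rn n. Y (\<lambda>i. y i + z i) \<le> Y y + Y z)"

definition unit_ball :: "nat \<Rightarrow> ((nat \<Rightarrow> real) \<Rightarrow> real) \<Rightarrow> (nat \<Rightarrow> real) set" where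
  "unit_ball n Y = {y \<in> Rn n. Y y \<le> 1}"

definition lipschitz_on_unit_ball ::
  "nat \<Rightarrow> ((nat \<Rightarrow> real) \<Rightarrow> real) \<Rightarrow> real \<Rightarrow> ((nat \<Rightarrow> real) \<Rightarrow> 'b::real_normed_vector) \<Rightarrow> bool" where
  "lipschitz_on_unit_ball n Y \<gamma> \<Phi> \<longleftrightarrow>
     (\<forall>y\<in>unit_ball n Y. \<forall>z\<in>unit_ball n Y. norm (\<Phi> y - \<Phi> z) \<le> \<gamma> * Y (\<lambda>i. y i - z i))"

text \<open>The width takes values in \<^typ>\<open>ennreal\<close>, a complete lattice, so that every infimum and
  supremum below is the actual one, without side conditions on boundedness.\<close>

definition lipschitz_width :: "nat \<Rightarrow> real \<Rightarrow> 'b::banach set \<Rightarrow> ennreal" where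
  "lipschitz_width n \<gamma> K =
     (INF Y\<in>{Y. norm_on_Rn n Y}.
        INF \<Phi>\<in>{\<Phi>. lipschitz_on_unit_ball n Y \<gamma> \<Phi>}.
          SUP f\<in>K. INF y\<in>unit_ball n Y. ennreal (norm (f - \<Phi> y)))"

end

theory Submission
  imports Defs "HOL-Real_Asymp.Real_Asymp"
begin

text \<open>Upper bound: with the nodes forming an \<open>\<epsilon>\<close>-net, \<open>\<epsilon> ~ N\<^sup>-\<^sup>1\<^sup>/\<^sup>d\<close>, the approximant is off by at
  most \<open>\<epsilon>\<close>; freezing the nodes and the slopes leaves a map of the \<open>N\<close> values \<open>f(x\<^sub>n)\<close> which is
  \<open>1\<close>-Lipschitz for the sup norm, hence competes in the width.
  Lower bound: an \<open>\<epsilon>\<close>-separated set of \<open>J ~ \<epsilon>\<^sup>-\<^sup>d\<close> points of \<open>X\<close> carries \<open>2\<^sup>J\<^sup>-\<^sup>1\<close> functions at mutual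
  distance at least \<open>\<epsilon>\<close>. If the width were below \<open>\<epsilon> / 4\<close>, these would pull back to a packing of the
  unit ball of an \<open>N\<close>-dimensional norm at scale \<open>\<epsilon> / 2\<gamma>\<close>, which has at most \<open>(16\<gamma> / \<epsilon>)\<^sup>N\<close> points.
  This is impossible for \<open>\<epsilon> = c (N log\<^sub>2 N)\<^sup>-\<^sup>1\<^sup>/\<^sup>d\<close> with \<open>c\<close> small.\<close>

section \<open>Norms on \<open>\<real>\<^sup>n\<close>\<close>

lemma Rn_lincomb: "y \<in> Rn n \<Longrightarrow> z \<in> Rn n \<Longrightarrow> (\<lambda>i. s * y i + t * z i) \<in> Rn n"
  by (simp add: Rn_def)

lemma Rn_diff: "y \<in> Rn n \<Longrightarrow> z \<in> Rn n \<Longrightarrow> (\<lambda>i. y i - z i) \<in> Rn n"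
  by (simp add: Rn_def)

lemma Rn_scale: "y \<in> Rn n \<Longrightarrow> (\<lambda>i. t * y i) \<in> Rn n"
  by (simp add: Rn_def)

context
  fixes n :: nat and Y :: "(nat \<Rightarrow> real) \<Rightarrow> real"
  assumes norm_Y: "norm_on_Rn n Y"
begin

lemma norm_Rn_nonneg: "y \<in> Rn n \<Longrightarrow> 0 \<le> Y y"
  using norm_Y by (simp add: norm_on_Rn_def)

lemma norm_Rn_zero_iff: "y \<in> Rn n \<Longrightarrow> Y y = 0 \<longleftrightarrow> (\<forall>i. y i = 0)"
  using norm_Y by (simp add: norm_on_Rn_def)

lemma norm_Rn_zero: "Y (\<lambda>i. 0) = 0"
  by (subst norm_Rn_zero_iff) (auto simp: Rn_def)

lemma norm_Rn_scale: "y \<in> Rn n \<Longrightarrow> Y (\<lambda>i. t * y i) = \<bar>t\<bar> * Y y"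
  using norm_Y by (simp add: norm_on_Rn_def)

lemma norm_Rn_triangle:
  "y \<in> Rn n \<Longrightarrow> z \<in> Rn n \<Longrightarrow> Y (\<lambda>i. y i + z i) \<le> Y y + Y z"
  using norm_Y by (simp add: norm_on_Rn_def)

lemma norm_Rn_diff_le:
  assumes "y \<in> Rn n" "z \<in> Rn n"
  shows "Y (\<lambda>i. y i - z i) \<le> Y y + Y z"
  using norm_Rn_triangle[OF assms(1) Rn_scale[OF assms(2), of "-1"]]
    norm_Rn_scale[OF assms(2), of "-1"] by simp

lemma norm_Rn_commute:
  assumes "y \<in> Rn n" "z \<in> Rn n"
  shows "Y (\<lambda>i. y i - z i) = Y (\<lambda>i. z i - y i)"
  using norm_Rn_scale[OF Rn_diff[OF assms], of "-1"] by simp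

lemma norm_Rn_diff_ge:
  assumes "y \<in> Rn n" "z \<in> Rn n"
  shows "Y y - Y z \<le> Y (\<lambda>i. y i - z i)"
  using norm_Rn_triangle[OF Rn_diff[OF assms] assms(2)] by simp

section \<open>Comparison of a norm with the coordinates\<close>

lemma norm_Rn_le_sum:
  assumes y: "y \<in> Rn n"
  shows "Y y \<le> (\<Sum>i=1..n. \<bar>y i\<bar> * Y (\<lambda>j. if j = i then 1 else 0))"
proof -
  define e :: "nat \<Rightarrow> nat \<Rightarrow> real" where "e i = (\<lambda>j. if j = i then 1 else 0)" for i
  \<comment> \<open>The vector is built up one coordinate at a time. Applied to differences, the
    bound makes \<open>Y\<close> continuous in the coordinates.\<close>
  have "Y (\<lambda>j. if j \<in> I then y j else 0) \<le> (\<Sum>i\<in>I. \<bar>y i\<bar> * Y (e i))"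
    if "finite I" "I \<subseteq> {1..n}" for I
    using that
  proof (induction I rule: finite_induct)
    case empty
    show ?case by (simp add: norm_Rn_zero)
  next
    case (insert i I)
    have e: "e i \<in> Rn n" and r: "(\<lambda>j. if j \<in> I then y j else 0) \<in> Rn n"
      using insert.prems by (auto simp: Rn_def e_def)
    have "(\<lambda>j. if j \<in> insert i I then y j else 0) =
        (\<lambda>j. y i * e i j + (if j \<in> I then y j else 0))"
      using insert.hyps by (auto simp: e_def)
    then show ?case
      using norm_Rn_triangle[OF Rn_scale[OF e] r, of "y i"] norm_Rn_scale[OF e, of "y i"] insert
      by simp
  qed
  from this[of "{1..n}"] have "Y (\<lambda>j. if j \<in> {1..n} then y j else 0) \<le> (\<Sum>i=1..n. \<bar>y i\<bar> * Y (e i))"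
    by blast
  moreover have "(\<lambda>j. if j \<in> {1..n} then y j else 0) = y"
    using y by (auto simp: Rn_def)
  ultimately show ?thesis by (simp add: e_def)
qed

text \<open>Equivalence of norms by compactness: \<open>Y\<close> attains a positive minimum on the
  sup-norm unit sphere, and homogeneity carries it to all of \<open>Rn n\<close>.\<close>

lemma norm_Rn_ge_coord:
  obtains c where "c > 0" "\<And>y i. y \<in> Rn n \<Longrightarrow> c * \<bar>y i\<bar> \<le> Y y"
proof -
  \<comment> \<open>\<open>S\<close> is the sup-norm unit sphere as the union of its faces. Pinning
    the coordinates outside \<open>{1..n}\<close> to 0 makes the cube
    \<open>Pi\<^sub>E UNIV Q\<close> compact by Tychonoff.\<close>
  define Q where "Q = (\<lambda>i. if i \<in> {1..n} then {-1..1::real} else {0})"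
  define S where "S = (\<Union>k\<in>{1..n}. {y \<in> Pi\<^sub>E UNIV Q. y k = 1 \<or> y k = -1})"
  have S_Rn: "y \<in> Rn n" if "y \<in> S" for y
  proof -
    have "y i \<in> Q i" for i using that by (auto simp: S_def PiE_iff)
    then have "y i = 0" if "i \<notin> {1..n}" for i using that by (metis Q_def singletonD)
    then show ?thesis by (simp add: Rn_def)
  qed
  have cont: "continuous_on S Y"
    unfolding continuous_on_def
  proof
    fix y assume y: "y \<in> S"
    \<comment> \<open>\<open>?b\<close> involves finitely many coordinates, so it is continuous in
      the product topology; it vanishes at \<open>y\<close> and dominates the increment of
      \<open>Y\<close>.\<close>
    let ?b = "\<lambda>x. \<Sum>i=1..n. \<bar>x i - y i\<bar> * Y (\<lambda>j. if j = i then 1 else 0)"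
    have "continuous_on S ?b"
      by (intro continuous_intros)
        (auto intro: continuous_on_product_coordinates continuous_on_subset)
    then have "(?b \<longlongrightarrow> ?b y) (at y within S)"
      using y unfolding continuous_on_def by blast
    then have lim: "(?b \<longlongrightarrow> 0) (at y within S)" by simp
    have "\<bar>Y x - Y y\<bar> \<le> ?b x" if "x \<in> S" for x
      using norm_Rn_diff_ge[of x y] norm_Rn_diff_ge[of y x] norm_Rn_commute[of x y]
        norm_Rn_le_sum[OF Rn_diff[of x n y]] S_Rn that y by fastforce
    then have "\<forall>\<^sub>F x in at y within S. norm (Y x - Y y) \<le> ?b x"
      by (auto simp: eventually_at_filter)
    from Lim_null_comparison[OF this lim] show "(Y \<longlongrightarrow> Y y) (at y within S)"
      by (simp add: LIM_zero_iff)
  qed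
  have "compact {y \<in> Pi\<^sub>E UNIV Q. y k = 1 \<or> y k = -1}" for k
  proof -
    have "compactin (product_topology (\<lambda>i. euclidean) UNIV) (Pi\<^sub>E UNIV Q)"
      by (subst compactin_PiE) (simp add: Q_def)
    then have "compact (Pi\<^sub>E UNIV Q)"
      by (simp add: euclidean_product_topology)
    moreover have "closed ((\<lambda>y::nat\<Rightarrow>real. y k) -` {1, -1})"
      by (rule closed_vimage) simp_all
    ultimately have "compact (Pi\<^sub>E UNIV Q \<inter> (\<lambda>y. y k) -` {1, -1})"
      by (rule compact_Int_closed)
    moreover have "{y \<in> Pi\<^sub>E UNIV Q. y k = 1 \<or> y k = -1} = Pi\<^sub>E UNIV Q \<inter> (\<lambda>y. y k) -` {1, -1}"
      by auto
    ultimately show ?thesis by simp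
  qed
  then have "compact S" unfolding S_def by (intro compact_UN) auto
  show thesis
  proof (cases "S = {}")
    case True
    \<comment> \<open>The sphere is empty only in dimension 0, where \<open>Rn n\<close> is the zero
      sequence and every \<open>c\<close> works.\<close>
    have "n = 0"
    proof (rule ccontr)
      assume "n \<noteq> 0"
      then have "(\<lambda>i. if i = 1 then 1 else 0) \<in> S" by (auto simp: S_def Q_def)
      with True show False by simp
    qed
    then show thesis using norm_Rn_nonneg by (intro that[of 1]) (auto simp: Rn_def)
  next
    case False
    with continuous_attains_inf[OF \<open>compact S\<close> _ cont]
    obtain y0 where y0: "y0 \<in> S" "\<And>y. y \<in> S \<Longrightarrow> Y y0 \<le> Y y" by blast
    have "\<exists>k. y0 k = 1 \<or> y0 k = -1" using y0(1) by (auto simp: S_def)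
    then have "\<exists>k. y0 k \<noteq> 0" by (metis zero_neq_one zero_neq_neg_one)
    then have "Y y0 \<noteq> 0" using S_Rn[OF y0(1)] by (simp add: norm_Rn_zero_iff)
    then have pos: "Y y0 > 0" using norm_Rn_nonneg[OF S_Rn[OF y0(1)]] by simp
    have "Y y0 * \<bar>y i\<bar> \<le> Y y" if y: "y \<in> Rn n" for y i
    proof (cases "i \<in> {1..n}")
      case False
      then show ?thesis using y norm_Rn_nonneg[OF y] by (simp add: Rn_def)
    next
      case True
      \<comment> \<open>\<open>t\<close> is the sup norm of \<open>y\<close>; when it is positive,
        the coordinate attaining it puts \<open>y / t\<close> on a face of \<open>S\<close>.\<close>
      define t where "t = (MAX k\<in>{1..n}. \<bar>y k\<bar>)"
      have le: "\<bar>y k\<bar> \<le> t" if "k \<in> {1..n}" for k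
        unfolding t_def using that by (intro Max_ge) auto
      have "t \<in> (\<lambda>k. \<bar>y k\<bar>) ` {1..n}"
        unfolding t_def using True by (intro Max_in) auto
      then obtain k where k: "k \<in> {1..n}" "t = \<bar>y k\<bar>" by blast
      show ?thesis
      proof (cases "t = 0")
        case True
        then have "y i = 0" using le[OF \<open>i \<in> _\<close>] by simp
        then show ?thesis using norm_Rn_nonneg[OF y] by simp
      next
        case False
        then have t: "t > 0" using k by simp
        have "(\<lambda>j. (1 / t) * y j) \<in> S"
          unfolding S_def
        proof (rule UN_I[OF k(1)], intro CollectI conjI)
          have "1 / t * y j \<in> Q j" for j
            using le[of j] t y by (auto simp: Q_def Rn_def abs_le_iff field_simps)
          then show "(\<lambda>j. 1 / t * y j) \<in> Pi\<^sub>E UNIV Q" by (simp add: PiE_iff)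
          show "1 / t * y k = 1 \<or> 1 / t * y k = -1"
            using k t by (auto simp: field_simps abs_if split: if_splits)
        qed
        from y0(2)[OF this] have "Y y0 \<le> (1 / t) * Y y"
          using norm_Rn_scale[OF y, of "1 / t"] t by simp
        then have "Y y0 * t \<le> Y y" using t by (simp add: field_simps)
        then show ?thesis using le[OF \<open>i \<in> _\<close>] pos
          by (meson mult_left_mono less_imp_le order_trans)
      qed
    qed
    then show thesis using that pos by blast
  qed
qed

section \<open>Packing numbers of the unit ball\<close>

text \<open>Coordinates are rounded down to a grid. \<open>C\<close> depends on the distortion of
  \<open>Y\<close> but not on \<open>s\<close>, which is all the iteration below requires; the
  radius 2 leaves room for iterated sums.\<close>

lemma norm_Rn_crude_packing:
  obtains C where "C > 0"
    "\<And>S s. \<lbrakk>finite S; S \<subseteq> Rn n; \<And>y. y \<in> S \<Longrightarrow> Y y \<le> 2; 0 < s; s \<le> 1;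
        pairwise (\<lambda>y z. s \<le> Y (\<lambda>i. y i - z i)) S\<rbrakk> \<Longrightarrow> real (card S) \<le> (C / s) ^ n"
proof -
  define A where "A = (\<Sum>i=1..n. Y (\<lambda>j. if j = i then 1 else 0))"
  have e: "(\<lambda>j. if j = i then 1 else 0) \<in> Rn n" if "i \<in> {1..n}" for i
    using that by (auto simp: Rn_def)
  have A: "A \<ge> 0" unfolding A_def by (intro sum_nonneg norm_Rn_nonneg e)
  obtain c where c: "c > 0" "\<And>y i. y \<in> Rn n \<Longrightarrow> c * \<bar>y i\<bar> \<le> Y y"
    using norm_Rn_ge_coord by blast
  \<comment> \<open>Read off from the final count: \<open>2 * L + 1\<close> is at most
    \<open>4 / (c * h) + 3\<close>, and \<open>3 \<le> 3 / s\<close> as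
    \<open>s \<le> 1\<close>.\<close>
  define C where "C = 4 * (A + 1) / c + 3"
  have "C > 0" using A c by (simp add: C_def add_nonneg_pos)
  moreover have "real (card S) \<le> (C / s) ^ n"
    if S: "finite S" "S \<subseteq> Rn n" "\<And>y. y \<in> S \<Longrightarrow> Y y \<le> 2" and s: "0 < s" "s \<le> 1"
      and sep: "pairwise (\<lambda>y z. s \<le> Y (\<lambda>i. y i - z i)) S" for S s
  proof -
    \<comment> \<open>Two points in one cell of mesh \<open>h\<close> are at
      \<open>Y\<close>-distance at most \<open>h * A\<close>. Dividing by \<open>A + 1\<close> makes
      this strictly less than \<open>s\<close>, also when \<open>A = 0\<close>.\<close>
    define h where "h = s / (A + 1)"
    have h: "h > 0" using s A by (simp add: h_def)
    define L where "L = \<lceil>2 / (c * h)\<rceil>"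
    define q where "q y = (\<lambda>i\<in>{1..n}. \<lfloor>y i / h\<rfloor>)" for y :: "nat \<Rightarrow> real"
    have "inj_on q S"
    proof (rule inj_onI, rule ccontr)
      fix y z assume yz: "y \<in> S" "z \<in> S" "q y = q z" "y \<noteq> z"
      then have Rn: "y \<in> Rn n" "z \<in> Rn n" using S by auto
      have "\<bar>y i - z i\<bar> \<le> h" if "i \<in> {1..n}" for i
      proof -
        have "\<lfloor>y i / h\<rfloor> = \<lfloor>z i / h\<rfloor>"
          using fun_cong[OF yz(3), of i] that by (simp add: q_def)
        then have "\<bar>y i / h - z i / h\<bar> \<le> 1" by linarith
        then have "\<bar>(y i - z i) / h\<bar> \<le> 1" by (simp add: diff_divide_distrib)
        then show ?thesis using h by (simp add: abs_divide)
      qed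
      then have "(\<Sum>i=1..n. \<bar>y i - z i\<bar> * Y (\<lambda>j. if j = i then 1 else 0)) \<le> h * A"
        unfolding A_def sum_distrib_left
        by (intro sum_mono mult_right_mono norm_Rn_nonneg e) auto
      then have "s \<le> h * A"
        using norm_Rn_le_sum[OF Rn_diff[OF Rn]] pairwiseD[OF sep yz(1,2,4)] by linarith
      moreover have "h * A < s" using s A by (simp add: h_def field_simps)
      ultimately show False by simp
    qed
    have "q ` S \<subseteq> {1..n} \<rightarrow>\<^sub>E {-L..L}"
    proof (rule image_subsetI)
      fix y assume y: "y \<in> S"
      have "\<lfloor>y i / h\<rfloor> \<in> {-L..L}" for i
      proof -
        have "c * \<bar>y i\<bar> \<le> 2" using c(2)[of y i] S y by force
        then have "\<bar>y i / h\<bar> \<le> 2 / (c * h)"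
          using c h by (simp add: field_simps abs_mult)
        then have "- (2 / (c * h)) \<le> y i / h" "y i / h \<le> 2 / (c * h)" by linarith+
        then show ?thesis unfolding L_def by simp linarith
      qed
      then show "q y \<in> {1..n} \<rightarrow>\<^sub>E {-L..L}" by (auto simp: q_def)
    qed
    then have "card (q ` S) \<le> card ({1..n} \<rightarrow>\<^sub>E {-L..L})"
      by (intro card_mono finite_PiE) auto
    then have "card S \<le> card {-L..L} ^ n"
      using card_image[OF \<open>inj_on q S\<close>] by (simp add: card_PiE)
    moreover have "real (card {-L..L}) \<le> C / s"
    proof -
      have "0 \<le> 2 / (c * h)" using c h by simp
      then have "L \<ge> 0" unfolding L_def by linarith
      then have "real (card {-L..L}) = 2 * real_of_int L + 1" by simp
      also have "\<dots> \<le> 4 / (c * h) + 3" unfolding L_def by linarith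
      also have "\<dots> \<le> 4 / (c * h) + 3 / s" using s by (simp add: field_simps)
      also have "\<dots> = C / s" using s A c by (simp add: C_def h_def field_simps)
      finally show ?thesis .
    qed
    then have "real (card {-L..L}) ^ n \<le> (C / s) ^ n" by (intro power_mono) auto
    ultimately show ?thesis
      by (metis of_nat_le_iff of_nat_power order_trans)
  qed
  ultimately show thesis using that by blast
qed

text \<open>The next set is \<open>S + (\<delta> / 8) T\<close>. Sums with the same
  \<open>S\<close>-part inherit the scaled separation of \<open>T\<close>; with distinct
  \<open>S\<close>-parts they stay at least
  \<open>\<delta> - \<delta> / 8 * 4 = \<delta> / 2\<close> apart, since \<open>T\<close> has
  diameter at most 4. The radius remains at most \<open>1 + 2 / 8 \<le> 2\<close>.\<close>

lemma norm_Rn_iterated_packing: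
  assumes S: "finite S" "S \<subseteq> unit_ball n Y"
    and \<delta>: "0 < \<delta>" "\<delta> \<le> 1"
    and sep: "pairwise (\<lambda>y z. \<delta> \<le> Y (\<lambda>i. y i - z i)) S"
  shows "\<exists>T. finite T \<and> T \<subseteq> Rn n \<and> (\<forall>y\<in>T. Y y \<le> 2) \<and> card T = card S ^ m \<and>
    pairwise (\<lambda>y z. (\<delta> / 8) ^ m \<le> Y (\<lambda>i. y i - z i)) T"
proof (induction m)
  case 0
  show ?case
    by (intro exI[of _ "{\<lambda>i. 0}"]) (auto simp: norm_Rn_zero Rn_def)
next
  case (Suc m)
  then obtain T where T: "finite T" "T \<subseteq> Rn n" "\<And>y. y \<in> T \<Longrightarrow> Y y \<le> 2" "card T = card S ^ m"
    "pairwise (\<lambda>y z. (\<delta> / 8) ^ m \<le> Y (\<lambda>i. y i - z i)) T" by blast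
  define g where "g = (\<lambda>(y, z). (\<lambda>i::nat. y i + \<delta> / 8 * z i :: real))"
  have SRn: "y \<in> Rn n" "Y y \<le> 1" if "y \<in> S" for y
    using that S by (auto simp: unit_ball_def)
  have sepg: "(\<delta> / 8) ^ Suc m \<le> Y (\<lambda>i. g p i - g p' i)"
    if "p \<in> S \<times> T" "p' \<in> S \<times> T" "p \<noteq> p'" for p p'
  proof -
    obtain y z y' z' where p: "p = (y, z)" "p' = (y', z')" by (metis surj_pair)
    have m: "y \<in> S" "y' \<in> S" "z \<in> T" "z' \<in> T" using that p by auto
    then have R: "y \<in> Rn n" "y' \<in> Rn n" "z \<in> Rn n" "z' \<in> Rn n" using SRn T by auto
    let ?dy = "\<lambda>i. y i - y' i" and ?dz = "\<lambda>i. z' i - z i"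
    have eq: "(\<lambda>i. g p i - g p' i) = (\<lambda>i. ?dy i - \<delta> / 8 * ?dz i)"
      by (simp add: g_def p algebra_simps diff_divide_distrib)
    show ?thesis
    proof (cases "y = y'")
      case True
      then have "z' \<noteq> z" using that p by auto
      then have "(\<delta> / 8) ^ m \<le> Y ?dz" using pairwiseD[OF T(5)] m by blast
      moreover have "Y (\<lambda>i. g p i - g p' i) = \<delta> / 8 * Y ?dz"
        using norm_Rn_scale[OF Rn_diff[OF R(4,3)], of "- (\<delta> / 8)"] \<delta> unfolding eq True
        by simp
      ultimately show ?thesis using \<delta> by simp
    next
      case False
      then have "\<delta> \<le> Y ?dy" using pairwiseD[OF sep] m by blast
      moreover have "Y ?dz \<le> 4" using norm_Rn_diff_le[OF R(4,3)] T(3)[OF m(3)] T(3)[OF m(4)] by simp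
      then have "\<delta> / 8 * Y ?dz \<le> \<delta> / 8 * 4" using \<delta> by (intro mult_left_mono) auto
      moreover have "Y ?dy - \<delta> / 8 * Y ?dz \<le> Y (\<lambda>i. g p i - g p' i)"
        using norm_Rn_diff_ge[OF Rn_diff[OF R(1,2)] Rn_scale[OF Rn_diff[OF R(4,3)], of "\<delta> / 8"]]
          norm_Rn_scale[OF Rn_diff[OF R(4,3)], of "\<delta> / 8"] \<delta> unfolding eq by simp
      moreover have "(\<delta> / 8) ^ Suc m \<le> \<delta> / 8"
        using \<delta> power_decreasing[of 1 "Suc m" "\<delta> / 8"] by simp
      ultimately show ?thesis using \<delta> by linarith
    qed
  qed
  \<comment> \<open>Separation at a positive scale makes distinct pairs have distinct sums, so
    cardinalities multiply.\<close>
  have inj: "inj_on g (S \<times> T)"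
  proof (rule inj_onI, rule ccontr)
    fix p p' assume "p \<in> S \<times> T" "p' \<in> S \<times> T" "g p = g p'" "p \<noteq> p'"
    with sepg[of p p'] norm_Rn_zero have "(\<delta> / 8) ^ Suc m \<le> 0" by simp
    moreover have "(\<delta> / 8) ^ Suc m > 0" using \<delta> by simp
    ultimately show False by linarith
  qed
  have "finite (g ` (S \<times> T))" using S T by simp
  moreover have "g ` (S \<times> T) \<subseteq> Rn n"
    using SRn T Rn_lincomb[of _ n _ 1 "\<delta> / 8"] by (auto simp: g_def)
  moreover have "Y w \<le> 2" if "w \<in> g ` (S \<times> T)" for w
  proof -
    obtain y z where w: "y \<in> S" "z \<in> T" "w = g (y, z)" using \<open>w \<in> _\<close> by auto
    then have R: "y \<in> Rn n" "z \<in> Rn n" using SRn T by auto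
    have "Y w \<le> Y y + \<delta> / 8 * Y z"
      using norm_Rn_triangle[OF R(1) Rn_scale[OF R(2)], of "\<delta> / 8"]
        norm_Rn_scale[OF R(2), of "\<delta> / 8"] \<delta> by (simp add: w g_def)
    moreover have "\<delta> / 8 * Y z \<le> 1 * 2 / 8"
      using mult_mono[of \<delta> 1 "Y z" 2] \<delta> T(3)[OF w(2)] norm_Rn_nonneg[OF R(2)] by simp
    ultimately show ?thesis using SRn(2)[OF w(1)] by simp
  qed
  moreover have "card (g ` (S \<times> T)) = card S ^ Suc m"
    using card_image[OF inj] T by (simp add: card_cartesian_product)
  moreover have "pairwise (\<lambda>y z. (\<delta> / 8) ^ Suc m \<le> Y (\<lambda>i. y i - z i)) (g ` (S \<times> T))"
    using sepg by (fastforce simp: pairwise_def)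
  ultimately show ?case by (intro exI[of _ "g ` (S \<times> T)"] conjI ballI)
qed

text \<open>The bound is free of the distortion between \<open>Y\<close> and the sup norm: iterating the packing
  \<open>m\<close> times at geometrically decreasing scales and letting \<open>m\<close> tend to infinity removes it.
  This replaces the usual comparison of volumes.\<close>

lemma norm_Rn_packing:
  assumes S: "finite S" "S \<subseteq> unit_ball n Y"
    and \<delta>: "0 < \<delta>" "\<delta> \<le> 1"
    and sep: "pairwise (\<lambda>y z. \<delta> \<le> Y (\<lambda>i. y i - z i)) S"
  shows "real (card S) \<le> (8 / \<delta>) ^ n"
proof (rule ccontr)
  obtain C where C: "C > 0"
    "\<And>S s. \<lbrakk>finite S; S \<subseteq> Rn n; \<And>y. y \<in> S \<Longrightarrow> Y y \<le> 2; 0 < s; s \<le> 1;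
        pairwise (\<lambda>y z. s \<le> Y (\<lambda>i. y i - z i)) S\<rbrakk> \<Longrightarrow> real (card S) \<le> (C / s) ^ n"
    using norm_Rn_crude_packing by blast
  define b where "b = (8 / \<delta>) ^ n"
  have b: "b > 0" using \<delta> by (simp add: b_def)
  assume "\<not> real (card S) \<le> (8 / \<delta>) ^ n"
  then have "1 < real (card S) / b" using b by (simp add: b_def)
  \<comment> \<open>\<open>C\<close> is fixed before \<open>m\<close>, so a ratio above 1 has a
    power beyond \<open>C ^ n\<close>, whereas the iterated packing bounds every such power by
    \<open>C ^ n\<close>.\<close>
  then obtain m where m: "C ^ n < (real (card S) / b) ^ m"
    using real_arch_pow by blast
  obtain T where T: "finite T" "T \<subseteq> Rn n" "\<And>y. y \<in> T \<Longrightarrow> Y y \<le> 2" "card T = card S ^ m"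
    "pairwise (\<lambda>y z. (\<delta> / 8) ^ m \<le> Y (\<lambda>i. y i - z i)) T"
    using norm_Rn_iterated_packing[OF S \<delta> sep, of m] by auto
  have "real (card T) \<le> (C / (\<delta> / 8) ^ m) ^ n"
    using \<delta> by (intro C(2) T power_le_one zero_less_power) auto
  also have "\<dots> = C ^ n * b ^ m"
    using \<delta> by (simp add: b_def power_divide power_mult_distrib flip: power_mult)
      (simp add: mult.commute)
  finally have "(real (card S) / b) ^ m \<le> C ^ n"
    using T(4) b by (simp add: power_divide field_simps)
  with m show False by simp
qed

end

text \<open>The norm used for the upper bound. \<open>n \<ge> 1\<close> because \<open>Max\<close>
  of the empty set has no specified value.\<close>

lemma norm_on_Rn_Max:
  assumes "n \<ge> 1"
  shows "norm_on_Rn n (\<lambda>y. MAX i\<in>{1..n}. \<bar>y i\<bar>)"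
proof -
  have ne: "{1..n} \<noteq> {}" using assms by simp
  have le: "\<bar>y i\<bar> \<le> (MAX i\<in>{1..n}. \<bar>y i\<bar>)" if "i \<in> {1..n}" for y :: "nat \<Rightarrow> real" and i
    using that by (intro Max_ge) auto
  have nonneg: "0 \<le> (MAX i\<in>{1..n}. \<bar>y i\<bar>)" for y :: "nat \<Rightarrow> real"
    using order_trans[OF abs_ge_zero le[of 1 y]] assms by simp
  have "(MAX i\<in>{1..n}. \<bar>y i\<bar>) = 0 \<longleftrightarrow> (\<forall>i. y i = 0)" if "y \<in> Rn n" for y
  proof
    assume "(MAX i\<in>{1..n}. \<bar>y i\<bar>) = 0"
    then have "y i = 0" if "i \<in> {1..n}" for i using le[OF that, of y] by simp
    with that show "\<forall>i. y i = 0" unfolding Rn_def by blast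
  next
    assume "\<forall>i. y i = 0"
    then show "(MAX i\<in>{1..n}. \<bar>y i\<bar>) = 0" using ne by (simp add: image_constant_conv)
  qed
  moreover have "(MAX i\<in>{1..n}. \<bar>t * y i\<bar>) = \<bar>t\<bar> * (MAX i\<in>{1..n}. \<bar>y i\<bar>)" for t and y :: "nat \<Rightarrow> real"
  proof -
    have "mono (\<lambda>x::real. \<bar>t\<bar> * x)" by (rule monoI) (simp add: mult_left_mono)
    from mono_Max_commute[OF this, of "(\<lambda>i. \<bar>y i\<bar>) ` {1..n}"] ne show ?thesis
      by (simp add: image_image abs_mult)
  qed
  moreover have "(MAX i\<in>{1..n}. \<bar>y i + z i\<bar>) \<le> (MAX i\<in>{1..n}. \<bar>y i\<bar>) + (MAX i\<in>{1..n}. \<bar>z i\<bar>)"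
    for y z :: "nat \<Rightarrow> real"
  proof (subst Max_le_iff)
    have "\<bar>y i + z i\<bar> \<le> (MAX i\<in>{1..n}. \<bar>y i\<bar>) + (MAX i\<in>{1..n}. \<bar>z i\<bar>)" if "i \<in> {1..n}" for i
      using abs_triangle_ineq[of "y i" "z i"] le[OF that, of y] le[OF that, of z] by linarith
    then show "\<forall>a\<in>(\<lambda>i. \<bar>y i + z i\<bar>) ` {1..n}.
        a \<le> (MAX i\<in>{1..n}. \<bar>y i\<bar>) + (MAX i\<in>{1..n}. \<bar>z i\<bar>)" by blast
  qed (use ne in auto)
  ultimately show ?thesis using nonneg unfolding norm_on_Rn_def by blast
qed

section \<open>The approximants\<close>

lemma abs_MIN_diff_le:
  fixes f g :: "'i \<Rightarrow> real"
  assumes "finite I" "I \<noteq> {}" "\<And>i. i \<in> I \<Longrightarrow> \<bar>f i - g i\<bar> \<le> e"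
  shows "\<bar>(MIN i\<in>I. f i) - (MIN i\<in>I. g i)\<bar> \<le> e"
proof -
  have *: "(MIN i\<in>I. f i) - e \<le> (MIN i\<in>I. g i)" if "\<And>i. i \<in> I \<Longrightarrow> f i \<le> g i + e" for f g
  proof -
    have "(MIN i\<in>I. f i) \<le> f i" if "i \<in> I" for i using that assms by (intro Min_le) auto
    with that show ?thesis using assms(1,2) by (subst Min_ge_iff) (fastforce simp: diff_le_eq)+
  qed
  have "f i \<le> g i + e" "g i \<le> f i + e" if "i \<in> I" for i using assms(3)[OF that] by linarith+
  with *[of f g] *[of g f] show ?thesis by fastforce
qed

lemma abs_MAX_diff_le:
  fixes f g :: "'i \<Rightarrow> real"
  assumes "finite I" "I \<noteq> {}" "\<And>i. i \<in> I \<Longrightarrow> \<bar>f i - g i\<bar> \<le> e"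
  shows "\<bar>(MAX i\<in>I. f i) - (MAX i\<in>I. g i)\<bar> \<le> e"
proof -
  have *: "(MAX i\<in>I. f i) \<le> (MAX i\<in>I. g i) + e" if "\<And>i. i \<in> I \<Longrightarrow> f i \<le> g i + e" for f g
  proof -
    have "g i \<le> (MAX i\<in>I. g i)" if "i \<in> I" for i using that assms by (intro Max_ge) auto
    with that show ?thesis using assms(1,2) by (subst Max_le_iff) fastforce+
  qed
  have "f i \<le> g i + e" "g i \<le> f i + e" if "i \<in> I" for i using assms(3)[OF that] by linarith+
  with *[of f g] *[of g f] show ?thesis by fastforce
qed

text \<open>Common core of two estimates: with all parameters varying it gives the bound by
  \<open>param_dist\<close>, with only the values \<open>a\<close> varying the sup-norm bound for
  the width. Minimum and maximum each move by at most \<open>e\<close>, hence so does their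
  average.\<close>

lemma norm_f_hat_diff_le:
  fixes \<theta> \<theta>' :: "'a::metric_space params"
  assumes compact: "compact (UNIV :: 'a set)" and N: "N \<ge> 1"
    and le: "\<And>m a b c a' b' c' x. \<lbrakk>m \<in> {1..N}; \<theta> m = (a, b, c); \<theta>' m = (a', b', c')\<rbrakk> \<Longrightarrow>
      \<bar>a - a'\<bar> + \<bar>c * dist x b - c' * dist x b'\<bar> \<le> e"
  shows "norm (f_hat N \<theta> - f_hat N \<theta>') \<le> e"
proof (rule norm_bound)
  fix x :: 'a
  have ne: "{1..N} \<noteq> {}" using N by simp
  have le': "\<bar>fst (\<theta> m) - fst (\<theta>' m)\<bar> +
      \<bar>snd (snd (\<theta> m)) * dist x (fst (snd (\<theta> m))) - snd (snd (\<theta>' m)) * dist x (fst (snd (\<theta>' m)))\<bar> \<le> e"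
    if "m \<in> {1..N}" for m
    using le[OF that, of "fst (\<theta> m)" "fst (snd (\<theta> m))" "snd (snd (\<theta> m))"
        "fst (\<theta>' m)" "fst (snd (\<theta>' m))" "snd (snd (\<theta>' m))"] by simp
  have "\<bar>f_hat_fun N \<theta> x - f_hat_fun N \<theta>' x\<bar> \<le> e"
  proof -
    let ?l = "\<lambda>\<theta> m. case \<theta> m of (a, b, c) \<Rightarrow> a + c * dist x b"
    let ?u = "\<lambda>\<theta> m. case \<theta> m of (a, b, c) \<Rightarrow> a - c * dist x b"
    have "\<bar>(MIN m\<in>{1..N}. ?l \<theta> m) - (MIN m\<in>{1..N}. ?l \<theta>' m)\<bar> \<le> e"
      using le' ne by (intro abs_MIN_diff_le) (fastforce simp: case_prod_beta abs_le_iff)+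
    moreover have "\<bar>(MAX m\<in>{1..N}. ?u \<theta> m) - (MAX m\<in>{1..N}. ?u \<theta>' m)\<bar> \<le> e"
      using le' ne by (intro abs_MAX_diff_le) (fastforce simp: case_prod_beta abs_le_iff)+
    ultimately show ?thesis unfolding f_hat_fun_def abs_le_iff by argo
  qed
  then show "norm (apply_bcontfun (f_hat N \<theta> - f_hat N \<theta>') x) \<le> e"
    by (simp add: apply_f_hat[OF compact] minus_bcontfun.rep_eq)
qed

text \<open>Each summand of \<open>param_dist\<close> controls the change of its own cone, and the
  sum dominates every summand.\<close>

lemma f_hat_lipschitz:
  fixes \<theta> \<theta>' :: "'a::metric_space params"
  assumes compact: "compact (UNIV :: 'a set)" and diam: "diameter (UNIV :: 'a set) \<le> 1"
    and N: "N \<ge> 1" and \<theta>: "\<theta> \<in> param_space N" "\<theta>' \<in> param_space N"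
  shows "norm (f_hat N \<theta> - f_hat N \<theta>') \<le> param_dist N \<theta> \<theta>'"
proof (rule norm_f_hat_diff_le[OF compact N])
  fix m a b c a' b' c' and x :: 'a
  assume m: "m \<in> {1..N}" "\<theta> m = (a, b, c)" "\<theta>' m = (a', b', c')"
  have "\<theta>' m \<in> {-1..1} \<times> UNIV \<times> {0..1}"
    using \<theta>(2) m(1) unfolding param_space_def by (rule PiE_mem)
  then have "c' \<in> {0..1}" using m(3) by simp
  moreover have "dist x b \<le> 1"
    using diameter_bounded_bound[OF compact_imp_bounded[OF compact], of x b] diam by simp
  \<comment> \<open>Slope and centre change one after the other: the change of slope is weighted by
    a distance at most 1, the change of centre by a slope at most 1.\<close>
  moreover have "c * dist x b - c' * dist x b' = (c - c') * dist x b + c' * (dist x b - dist x b')"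
    by (simp add: algebra_simps)
  then have "\<bar>c * dist x b - c' * dist x b'\<bar> \<le> \<bar>c - c'\<bar> * dist x b + \<bar>c'\<bar> * \<bar>dist x b - dist x b'\<bar>"
    by (metis abs_triangle_ineq abs_mult abs_of_nonneg zero_le_dist)
  moreover have "\<bar>dist x b - dist x b'\<bar> \<le> dist b b'"
    using dist_triangle[of x b b'] dist_triangle[of x b' b] by (simp add: dist_commute)
  ultimately have "\<bar>c * dist x b - c' * dist x b'\<bar> \<le> \<bar>c - c'\<bar> + dist b b'"
    using mult_mono[of "\<bar>c'\<bar>" 1 "\<bar>dist x b - dist x b'\<bar>" "dist b b'"]
      mult_left_mono[of "dist x b" 1 "\<bar>c - c'\<bar>"] by simp
  moreover have "\<bar>a - a'\<bar> + dist b b' + \<bar>c - c'\<bar> \<le> param_dist N \<theta> \<theta>'"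
    unfolding param_dist_def
    using member_le_sum[OF m(1), of "\<lambda>m. case (\<theta> m, \<theta>' m) of
      ((a, b, c), (a', b', c')) \<Rightarrow> \<bar>a - a'\<bar> + dist b b' + \<bar>c - c'\<bar>"] m
    by (simp add: case_prod_beta)
  ultimately show "\<bar>a - a'\<bar> + \<bar>c * dist x b - c' * dist x b'\<bar> \<le> param_dist N \<theta> \<theta>'"
    by simp
qed

section \<open>Error of the approximant on the function class\<close>

lemma lip_classD:
  assumes "f \<in> lip_class"
  shows "\<bar>apply_bcontfun f x - apply_bcontfun f y\<bar> \<le> dist x y" "\<bar>apply_bcontfun f x\<bar> \<le> 1"
proof -
  show "\<bar>apply_bcontfun f x - apply_bcontfun f y\<bar> \<le> dist x y"
    using assms lipschitz_onD[of 1 UNIV "apply_bcontfun f" x y]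
    by (auto simp: lip_class_def dist_real_def)
  have "range (apply_bcontfun f) \<subseteq> {-1..1}" using assms by (simp add: lip_class_def)
  then have "apply_bcontfun f x \<in> {-1..1}" by blast
  then show "\<bar>apply_bcontfun f x\<bar> \<le> 1" by auto
qed

text \<open>The maximum in \<open>f_hat_fun\<close> lies in \<open>[f - 2\<epsilon>, f]\<close> and the minimum in
  \<open>[f, f + 2\<epsilon>]\<close>, so averaging them halves the error.\<close>

lemma norm_f_hat_theta_of_le:
  fixes f :: "'a::metric_space \<Rightarrow>\<^sub>C real"
  assumes compact: "compact (UNIV :: 'a set)"
    and net: "\<And>x. \<exists>m\<in>{1..N}. dist x (p m) \<le> \<epsilon>"
    and f: "f \<in> lip_class"
  shows "norm (f - f_hat N (theta_of N p f)) \<le> \<epsilon>"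
proof (rule norm_bound)
  fix x :: 'a
  obtain k where k: "k \<in> {1..N}" "dist x (p k) \<le> \<epsilon>" using net by blast
  let ?u = "\<lambda>m. apply_bcontfun f (p m) + dist x (p m)"
  let ?l = "\<lambda>m. apply_bcontfun f (p m) - dist x (p m)"
  have eq: "f_hat_fun N (theta_of N p f) x = 1 / 2 * ((MIN m\<in>{1..N}. ?u m) + (MAX m\<in>{1..N}. ?l m))"
    by (simp add: f_hat_fun_def theta_of_def cong: image_cong_simp)
  have m: "\<bar>apply_bcontfun f x - apply_bcontfun f (p m)\<bar> \<le> dist x (p m)" for m
    using lip_classD(1)[OF f] .
  have "apply_bcontfun f x \<le> (MIN m\<in>{1..N}. ?u m)"
    using k m by (subst Min_ge_iff) (auto simp: abs_le_iff diff_le_eq add.commute)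
  moreover have "(MIN m\<in>{1..N}. ?u m) \<le> ?u k" using k by (intro Min_le) auto
  moreover have "(MAX m\<in>{1..N}. ?l m) \<le> apply_bcontfun f x"
    using k m by (subst Max_le_iff) (auto simp: abs_le_iff diff_le_eq add.commute)
  moreover have "?l k \<le> (MAX m\<in>{1..N}. ?l m)" using k by (intro Max_ge) auto
  ultimately have "\<bar>apply_bcontfun f x - f_hat_fun N (theta_of N p f) x\<bar> \<le> \<epsilon>"
    using m[of k] k(2) unfolding eq abs_le_iff by argo
  then show "norm (apply_bcontfun (f - f_hat N (theta_of N p f)) x) \<le> \<epsilon>"
    by (simp add: apply_f_hat[OF compact] minus_bcontfun.rep_eq)
qed

section \<open>Upper and lower bounds for the width\<close>

text \<open>The sup norm and the map \<open>\<Phi>\<close> from values to the approximant with nodes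
  \<open>p\<close> and slopes 1 compete in the infima. The samples of a function in the class lie in
  the unit ball since they are bounded by 1.\<close>

lemma lipschitz_width_lip_class_le:
  fixes p :: "nat \<Rightarrow> 'a::metric_space"
  assumes compact: "compact (UNIV :: 'a set)" and N: "N \<ge> 1" and \<gamma>: "\<gamma> \<ge> 1"
  shows "lipschitz_width N \<gamma> (lip_class :: ('a \<Rightarrow>\<^sub>C real) set)
    \<le> (SUP f\<in>lip_class. ennreal (norm (f - f_hat N (theta_of N p f))))"
proof -
  define Y where "Y = (\<lambda>y::nat\<Rightarrow>real. MAX i\<in>{1..N}. \<bar>y i\<bar>)"
  define \<Phi> where "\<Phi> y = f_hat N (\<lambda>m\<in>{1..N}. (y m, p m, 1))" for y
  have Y: "norm_on_Rn N Y" unfolding Y_def by (rule norm_on_Rn_Max[OF N])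
  have le: "\<bar>y i\<bar> \<le> Y y" if "i \<in> {1..N}" for y i
    unfolding Y_def using that by (intro Max_ge) auto
  have "lipschitz_on_unit_ball N Y \<gamma> \<Phi>"
    unfolding lipschitz_on_unit_ball_def
  proof safe
    fix y z assume "y \<in> unit_ball N Y" "z \<in> unit_ball N Y"
    then have "0 \<le> Y (\<lambda>i. y i - z i)"
      by (intro norm_Rn_nonneg[OF Y] Rn_diff) (auto simp: unit_ball_def)
    moreover have "norm (\<Phi> y - \<Phi> z) \<le> Y (\<lambda>i. y i - z i)"
      unfolding \<Phi>_def using le[of _ "\<lambda>i. y i - z i"]
      by (intro norm_f_hat_diff_le[OF compact N]) auto
    ultimately show "norm (\<Phi> y - \<Phi> z) \<le> \<gamma> * Y (\<lambda>i. y i - z i)"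
      using mult_right_mono[OF \<gamma>] by fastforce
  qed
  moreover have "(INF y\<in>unit_ball N Y. ennreal (norm (f - \<Phi> y)))
      \<le> ennreal (norm (f - f_hat N (theta_of N p f)))" if f: "f \<in> lip_class" for f
  proof (rule INF_lower2)
    \<comment> \<open>The samples are continued by 0 so as to lie in \<open>Rn N\<close>;
      \<open>\<Phi>\<close> reads only the indices in \<open>{1..N}\<close>.\<close>
    let ?y = "\<lambda>m. if m \<in> {1..N} then apply_bcontfun f (p m) else 0"
    have "Y ?y \<le> 1" unfolding Y_def using N lip_classD(2)[OF f] by (subst Max_le_iff) auto
    then show "?y \<in> unit_ball N Y" by (auto simp: unit_ball_def Rn_def)
    have "(\<lambda>m\<in>{1..N}. (?y m, p m, 1)) = theta_of N p f"
      by (auto simp: theta_of_def)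
    then show "ennreal (norm (f - \<Phi> ?y)) \<le> ennreal (norm (f - f_hat N (theta_of N p f)))"
      unfolding \<Phi>_def by (metis order_refl)
  qed
  ultimately show ?thesis
    unfolding lipschitz_width_def using Y
    by (intro INF_lower2[of Y] INF_lower2[of \<Phi>] SUP_mono) auto
qed

text \<open>If every member of \<open>F\<close> were closer than \<open>\<epsilon> / 4\<close> to an
  image of \<open>\<Phi>\<close>, the chosen images would be \<open>\<epsilon> / 2\<close> apart and
  their parameters \<open>\<epsilon> / (2 * \<gamma>)\<close> apart in the unit ball. The 16 is the
  8 of \<open>norm_Rn_packing\<close> times this 2; \<open>\<epsilon> \<le> 2 * \<gamma>\<close>
  keeps the scale at most 1.\<close>

lemma lipschitz_width_ge:
  fixes K :: "'b::banach set"
  assumes F: "finite F" "F \<subseteq> K" and sep: "pairwise (\<lambda>f g. \<epsilon> \<le> norm (f - g)) F"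
    and \<epsilon>: "0 < \<epsilon>" "\<epsilon> \<le> 2 * \<gamma>" and card: "(16 * \<gamma> / \<epsilon>) ^ N < real (card F)"
  shows "ennreal (\<epsilon> / 4) \<le> lipschitz_width N \<gamma> K"
  unfolding lipschitz_width_def
proof (intro INF_greatest, rule ccontr)
  fix Y and \<Phi> :: "(nat \<Rightarrow> real) \<Rightarrow> 'b"
  assume "Y \<in> {Y. norm_on_Rn N Y}" and "\<Phi> \<in> {\<Phi>. lipschitz_on_unit_ball N Y \<gamma> \<Phi>}"
  then have Y: "norm_on_Rn N Y" and \<Phi>: "lipschitz_on_unit_ball N Y \<gamma> \<Phi>" by simp_all
  have lip: "norm (\<Phi> y - \<Phi> z) \<le> \<gamma> * Y (\<lambda>i. y i - z i)"
    if "y \<in> unit_ball N Y" "z \<in> unit_ball N Y" for y z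
    using \<Phi> that by (simp add: lipschitz_on_unit_ball_def)
  assume "\<not> ennreal (\<epsilon> / 4) \<le> (SUP f\<in>K. INF y\<in>unit_ball N Y. ennreal (norm (f - \<Phi> y)))"
  then have less: "(SUP f\<in>K. INF y\<in>unit_ball N Y. ennreal (norm (f - \<Phi> y))) < ennreal (\<epsilon> / 4)"
    by simp
  have "\<exists>y\<in>unit_ball N Y. norm (f - \<Phi> y) < \<epsilon> / 4" if "f \<in> F" for f
  proof -
    have "(INF y\<in>unit_ball N Y. ennreal (norm (f - \<Phi> y))) < ennreal (\<epsilon> / 4)"
      using F that by (intro le_less_trans[OF SUP_upper less]) auto
    then show ?thesis by (auto simp: INF_less_iff ennreal_less_iff)
  qed
  then obtain y where y: "\<And>f. f \<in> F \<Longrightarrow> y f \<in> unit_ball N Y"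
    "\<And>f. f \<in> F \<Longrightarrow> norm (f - \<Phi> (y f)) < \<epsilon> / 4" by metis
  define \<delta> where "\<delta> = \<epsilon> / (2 * \<gamma>)"
  have \<delta>: "0 < \<delta>" "\<delta> \<le> 1" using \<epsilon> by (auto simp: \<delta>_def)
  have y_sep: "\<delta> \<le> Y (\<lambda>i. y f i - y g i)" if fg: "f \<in> F" "g \<in> F" "f \<noteq> g" for f g
  proof -
    have "f - g = (f - \<Phi> (y f)) + (\<Phi> (y f) - \<Phi> (y g)) - (g - \<Phi> (y g))" by simp
    then have "norm (f - g) \<le> norm (f - \<Phi> (y f)) + norm (\<Phi> (y f) - \<Phi> (y g)) + norm (g - \<Phi> (y g))"
      by (metis norm_triangle_ineq norm_triangle_ineq4 order_trans add_right_mono)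
    then have "\<epsilon> / 2 \<le> \<gamma> * Y (\<lambda>i. y f i - y g i)"
      using y(2)[OF fg(1)] y(2)[OF fg(2)] pairwiseD[OF sep fg] lip[OF y(1) y(1), OF fg(1,2)]
      by linarith
    then show ?thesis using \<epsilon> by (simp add: \<delta>_def field_simps)
  qed
  have inj: "inj_on y F"
  proof (rule inj_onI, rule ccontr)
    fix f g assume "f \<in> F" "g \<in> F" "y f = y g" "f \<noteq> g"
    with y_sep[of f g] norm_Rn_zero[OF Y] \<delta> show False by simp
  qed
  have "real (card (y ` F)) \<le> (8 / \<delta>) ^ N"
    using F y(1) y_sep by (intro norm_Rn_packing[OF Y _ _ \<delta>]) (auto simp: pairwise_def)
  moreover have "8 / \<delta> = 16 * \<gamma> / \<epsilon>" by (simp add: \<delta>_def)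
  ultimately show False using card card_image[OF inj] by simp
qed

text \<open>The functions are the distances to \<open>P - T\<close>. The point \<open>p0\<close> is kept out of \<open>T\<close> because
  \<open>infdist\<close> to the empty set is \<open>0\<close>.\<close>

lemma lip_class_packing:
  fixes P :: "'a::metric_space set"
  assumes compact: "compact (UNIV :: 'a set)" and diam: "diameter (UNIV :: 'a set) \<le> 1"
    and P: "finite P" "P \<noteq> {}" and \<epsilon>: "0 < \<epsilon>"
    and sep: "pairwise (\<lambda>x y. \<epsilon> \<le> dist x y) P"
  obtains F :: "('a \<Rightarrow>\<^sub>C real) set" where "finite F" "F \<subseteq> lip_class"
    "pairwise (\<lambda>f g. \<epsilon> \<le> norm (f - g)) F" "card F = 2 ^ (card P - 1)"
proof -
  obtain p0 where p0: "p0 \<in> P" using P by blast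
  define g where "g T = Bcontfun (\<lambda>x. infdist x (P - T))" for T
  have dist1: "dist x y \<le> 1" for x y :: 'a
    using diameter_bounded_bound[OF compact_imp_bounded[OF compact], of x y] diam by simp
  have inf1: "infdist x (P - T) \<in> {0..1}" if "T \<subseteq> P - {p0}" for x T
    using infdist_le[of p0 "P - T" x] dist1[of x p0] that p0 infdist_nonneg[of x "P - T"]
    by force
  have g: "apply_bcontfun (g T) x = infdist x (P - T)" if "T \<subseteq> P - {p0}" for T x
  proof -
    have "bounded (range (\<lambda>x. infdist x (P - T)))"
      using inf1[OF that] by (intro bounded_subset[OF bounded_closed_interval[of 0 "1::real"]]) blast
    then have "(\<lambda>x. infdist x (P - T)) \<in> bcontfun"
      by (auto simp: bcontfun_def intro!: continuous_intros)
    then show ?thesis by (simp add: g_def Bcontfun_inverse)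
  qed
  have lip: "g T \<in> lip_class" if T: "T \<subseteq> P - {p0}" for T
  proof -
    have "1-lipschitz_on UNIV (\<lambda>x. infdist x (P - T))"
    proof (rule lipschitz_onI)
      fix x y
      show "dist (infdist x (P - T)) (infdist y (P - T)) \<le> 1 * dist x y"
        using infdist_triangle[of x "P - T" y] infdist_triangle[of y "P - T" x]
        by (simp add: dist_real_def abs_le_iff dist_commute)
    qed simp
    moreover have "infdist x (P - T) \<in> {-1..1}" for x using inf1[OF T, of x] by auto
    moreover have "apply_bcontfun (g T) = (\<lambda>x. infdist x (P - T))"
      using g[OF T] by blast
    ultimately show ?thesis by (auto simp: lip_class_def)
  qed
  \<comment> \<open>The point \<open>p\<close> tells the functions apart: \<open>g T'\<close>
    vanishes there, while \<open>g T\<close> is at least \<open>\<epsilon>\<close> since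
    \<open>p\<close> is missing from \<open>P - T\<close>.\<close>
  have far: "\<epsilon> \<le> norm (g T - g T')"
    if T: "T \<subseteq> P - {p0}" "T' \<subseteq> P - {p0}" "p \<in> T" "p \<notin> T'" for T T' p
  proof -
    have p: "p \<in> P" "p \<in> P - T'" using T by auto
    have "\<epsilon> \<le> infdist p (P - T)"
      unfolding infdist_def
    proof -
      have "\<epsilon> \<le> (INF a\<in>P - T. dist p a)"
        using T p0 pairwiseD[OF sep p(1)] by (intro cINF_greatest) auto
      then show "\<epsilon> \<le> (if P - T = {} then 0 else INF a\<in>P - T. dist p a)"
        using T p0 by auto
    qed
    moreover have "infdist p (P - T') = 0" using p by simp
    moreover have "norm (apply_bcontfun (g T - g T') p) \<le> norm (g T - g T')"
      by (rule norm_bounded)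
    ultimately show ?thesis
      using g[OF T(1), of p] g[OF T(2), of p] by (simp add: minus_bcontfun.rep_eq)
  qed
  have sep': "\<epsilon> \<le> norm (g T - g T')"
    if "T \<in> Pow (P - {p0})" "T' \<in> Pow (P - {p0})" "T \<noteq> T'" for T T'
  proof -
    obtain p where "p \<in> T \<and> p \<notin> T' \<or> p \<in> T' \<and> p \<notin> T" using \<open>T \<noteq> T'\<close> by blast
    then show ?thesis using far[of T T' p] far[of T' T p] that by (auto simp: norm_minus_commute)
  qed
  have inj: "inj_on g (Pow (P - {p0}))"
  proof (rule inj_onI, rule ccontr)
    fix T T' assume "T \<in> Pow (P - {p0})" "T' \<in> Pow (P - {p0})" "g T = g T'" "T \<noteq> T'"
    with sep'[of T T'] \<epsilon> show False by simp
  qed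
  show thesis
  proof (rule that[of "g ` Pow (P - {p0})"])
    show "card (g ` Pow (P - {p0})) = 2 ^ (card P - 1)"
      using P p0 by (simp add: card_image[OF inj] card_Pow)
    show "pairwise (\<lambda>f g. \<epsilon> \<le> norm (f - g)) (g ` Pow (P - {p0}))"
      using sep' unfolding pairwise_def by blast
  qed (use P lip in auto)
qed

section \<open>Separated nets in Ahlfors regular spaces\<close>

text \<open>A separated set of maximal cardinality is a net, as a point far from it could be added.
  Total boundedness bounds the cardinality: a ball of radius \<open>\<epsilon> / 2\<close> contains
  at most one point of a separated set.\<close>

lemma compact_separated_net:
  fixes \<epsilon> :: real
  assumes compact: "compact (UNIV :: 'a::metric_space set)" and \<epsilon>: "\<epsilon> > 0"
  obtains P :: "'a::metric_space set" where "finite P" "pairwise (\<lambda>x y. \<epsilon> \<le> dist x y) P"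
    "\<And>x. \<exists>p\<in>P. dist x p < \<epsilon>"
proof -
  let ?sep = "\<lambda>P :: 'a set. finite P \<and> pairwise (\<lambda>x y. \<epsilon> \<le> dist x y) P"
  obtain k :: "'a set" where k: "finite k" "UNIV \<subseteq> (\<Union>x\<in>k. ball x (\<epsilon> / 2))"
    using compact \<epsilon> unfolding compact_eq_totally_bounded by (meson half_gt_zero)
  have "card P \<le> card k" if P: "?sep P" for P :: "'a set"
  proof -
    have "\<forall>x. \<exists>c\<in>k. dist c x < \<epsilon> / 2" using k(2) by force
    then obtain c where c: "\<And>x. c x \<in> k" "\<And>x. dist (c x) x < \<epsilon> / 2" by metis
    have "inj_on c P"
    proof (rule inj_onI, rule ccontr)
      fix x y assume xy: "x \<in> P" "y \<in> P" "c x = c y" "x \<noteq> y"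
      then have "\<epsilon> \<le> dist x y" using P by (auto simp: pairwise_def)
      moreover have "dist x y \<le> dist (c x) x + dist (c x) y" by (rule dist_triangle3)
      ultimately show False using c(2)[of x] c(2)[of y] xy(3) by simp
    qed
    then show ?thesis using c(1) k(1) by (intro card_inj_on_le) auto
  qed
  moreover have "?sep {}" by simp
  ultimately have "\<exists>P. ?sep P \<and> (\<forall>Q. ?sep Q \<longrightarrow> card Q \<le> card P)"
    by (intro ex_has_greatest_nat[of ?sep "{}" card "Suc (card k)"]) (auto simp: less_Suc_eq_le)
  then obtain P where P: "?sep P" "\<And>Q. ?sep Q \<Longrightarrow> card Q \<le> card P"
    by blast
  have "\<exists>p\<in>P. dist x p < \<epsilon>" for x
  proof (rule ccontr)
    assume far: "\<not> (\<exists>p\<in>P. dist x p < \<epsilon>)"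
    then have "x \<notin> P" using \<epsilon> by force
    moreover have "?sep (insert x P)"
      using P(1) far by (auto simp: pairwise_insert not_less dist_commute)
    ultimately show False using P(2)[of "insert x P"] P(1) by simp
  qed
  then show thesis using that P(1) by blast
qed

text \<open>Both counts compare with the total mass: the balls of radius \<open>\<epsilon>\<close>
  about the net cover the space, those of radius \<open>\<epsilon> / 2\<close> are disjoint.\<close>

lemma ahlfors_separated_net:
  fixes M :: "'a::metric_space measure"
  assumes compact: "compact (UNIV :: 'a set)" and ahlfors: "ahlfors_regular d M"
    and diam_pos: "0 < diameter (UNIV :: 'a set)"
  obtains k1 k2 where "0 < k1" "0 < k2"
    "\<And>\<epsilon>. \<lbrakk>0 < \<epsilon>; \<epsilon> \<le> diameter (UNIV :: 'a set)\<rbrakk> \<Longrightarrow>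
      \<exists>P :: 'a set. finite P \<and> pairwise (\<lambda>x y. \<epsilon> \<le> dist x y) P \<and> (\<forall>x. \<exists>p\<in>P. dist x p < \<epsilon>) \<and>
        k1 * \<epsilon> powr (- d) \<le> real (card P) \<and> real (card P) \<le> k2 * \<epsilon> powr (- d)"
proof -
  define D where "D = diameter (UNIV :: 'a set)"
  have D: "D > 0" using diam_pos by (simp add: D_def)
  from ahlfors compact_imp_bounded[OF compact] obtain cA CA where
    sets: "sets M = sets borel" and c: "0 < cA" "cA \<le> CA"
    and reg: "\<And>x r. 0 < r \<Longrightarrow> r \<le> D \<Longrightarrow> ennreal (cA * r powr d) \<le> emeasure M (ball x r)"
      "\<And>x r. 0 < r \<Longrightarrow> r \<le> D \<Longrightarrow> emeasure M (ball x r) \<le> ennreal (CA * r powr d)"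
    unfolding ahlfors_regular_def D_def by blast
  have space: "space M = UNIV" using sets_eq_imp_space_eq[OF sets] by simp
  have ball: "ball x r \<in> sets M" for x r by (simp add: sets)
  obtain P0 :: "'a set" where P0: "finite P0" "\<And>x. \<exists>p\<in>P0. dist x p < D"
    using compact_separated_net[OF compact D] by metis
  \<comment> \<open>Finitely many balls of radius \<open>D\<close> cover the space, each of finite
    mass by the upper regularity bound.\<close>
  interpret finite_measure M
  proof
    have "emeasure M (\<Union>p\<in>P0. ball p D) \<le> (\<Sum>p\<in>P0. emeasure M (ball p D))"
      using P0 ball by (intro emeasure_subadditive_finite) auto
    also have "\<dots> \<le> (\<Sum>p\<in>P0. ennreal (CA * D powr d))"
      using D by (intro sum_mono reg) auto
    also have "\<dots> < \<infinity>" using P0 by (simp add: ennreal_mult_less_top of_nat_less_top)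
    finally have "emeasure M (\<Union>p\<in>P0. ball p D) < \<infinity>" .
    moreover have "(\<Union>p\<in>P0. ball p D) = UNIV" using P0(2) by (force simp: dist_commute)
    ultimately show "emeasure M (space M) \<noteq> \<infinity>" by (simp add: space)
  qed
  have meas: "cA * r powr d \<le> measure M (ball x r)" "measure M (ball x r) \<le> CA * r powr d"
    if "0 < r" "r \<le> D" for x r
    using reg[OF that, of x] c by (auto simp: emeasure_eq_measure)
  define m where "m = measure M UNIV"
  \<comment> \<open>One ball already has positive mass; \<open>undefined\<close> stands for an
    arbitrary point.\<close>
  have "0 < cA * D powr d" using c D by simp
  also have "\<dots> \<le> measure M (ball undefined D)" using D by (intro meas) auto
  also have "\<dots> \<le> m" unfolding m_def using bounded_measure[of "ball undefined D"] by (simp add: space)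
  finally have m: "m > 0" .
  \<comment> \<open>The first constant comes from the cover, the second from the disjoint balls of
    half the radius.\<close>
  show thesis
  proof (rule that[of "m / CA" "m * 2 powr d / cA"])
    show "0 < m / CA" "0 < m * 2 powr d / cA" using m c by simp_all
    fix \<epsilon> :: real assume \<epsilon>: "0 < \<epsilon>" "\<epsilon> \<le> diameter (UNIV :: 'a set)"
    obtain P :: "'a set" where P: "finite P" "pairwise (\<lambda>x y. \<epsilon> \<le> dist x y) P"
      "\<And>x. \<exists>p\<in>P. dist x p < \<epsilon>"
      using compact_separated_net[OF compact \<epsilon>(1)] by metis
    have "m \<le> real (card P) * (CA * \<epsilon> powr d)"
    proof -
      have "(\<Union>p\<in>P. ball p \<epsilon>) = UNIV" using P(3) by (force simp: dist_commute)
      then have "m \<le> (\<Sum>p\<in>P. measure M (ball p \<epsilon>))"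
        using finite_measure_subadditive_finite[OF P(1), of "\<lambda>p. ball p \<epsilon>"] ball
        by (simp add: m_def image_subset_iff)
      also have "\<dots> \<le> (\<Sum>p\<in>P. CA * \<epsilon> powr d)"
        using \<epsilon> by (intro sum_mono meas) (auto simp: D_def)
      finally show ?thesis by simp
    qed
    then have lower: "m / CA * \<epsilon> powr (- d) \<le> real (card P)"
      using c \<epsilon> by (simp add: powr_minus field_simps)
    have "real (card P) * (cA * (\<epsilon> / 2) powr d) \<le> m"
    proof -
      have "disjoint_family_on (\<lambda>p. ball p (\<epsilon> / 2)) P"
      proof (unfold disjoint_family_on_def, intro ballI impI)
        fix p q assume pq: "p \<in> P" "q \<in> P" "p \<noteq> q"
        have "\<not> (dist p z < \<epsilon> / 2 \<and> dist q z < \<epsilon> / 2)" for z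
          using pairwiseD[OF P(2) pq] dist_triangle2[of p q z] by linarith
        then show "ball p (\<epsilon> / 2) \<inter> ball q (\<epsilon> / 2) = {}" by auto
      qed
      then have "(\<Sum>p\<in>P. measure M (ball p (\<epsilon> / 2))) = measure M (\<Union>p\<in>P. ball p (\<epsilon> / 2))"
        using P(1) ball by (subst finite_measure_finite_Union) auto
      also have "\<dots> \<le> m" using bounded_measure[of "\<Union>p\<in>P. ball p (\<epsilon> / 2)"] by (simp add: m_def space)
      moreover have "(\<Sum>p\<in>P. cA * (\<epsilon> / 2) powr d) \<le> (\<Sum>p\<in>P. measure M (ball p (\<epsilon> / 2)))"
        using \<epsilon> by (intro sum_mono meas) (auto simp: D_def)
      ultimately show ?thesis by simp
    qed
    then have upper: "real (card P) \<le> m * 2 powr d / cA * \<epsilon> powr (- d)"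
      using c \<epsilon> by (simp add: powr_minus powr_divide field_simps)
    show "\<exists>P :: 'a set. finite P \<and> pairwise (\<lambda>x y. \<epsilon> \<le> dist x y) P \<and> (\<forall>x. \<exists>p\<in>P. dist x p < \<epsilon>) \<and>
        m / CA * \<epsilon> powr (- d) \<le> real (card P) \<and> real (card P) \<le> m * 2 powr d / cA * \<epsilon> powr (- d)"
      using P lower upper by blast
  qed
qed

section \<open>The two-sided estimate\<close>

text \<open>A power of \<open>1 / c\<close> outgrows its logarithm as \<open>c\<close> tends to 0.
  The inequality is what remains of the counting below once the factor \<open>N * log 2 N\<close> is
  divided out, so \<open>c\<close> can be chosen independently of \<open>N\<close>.\<close>

lemma exists_packing_scale:
  fixes k d \<gamma> D :: real
  assumes "k > 0" "d > 0" "\<gamma> > 0" "D > 0"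
  obtains c where "0 < c" "c \<le> D" "log 2 (16 * \<gamma> / c) + 2 / d < k * c powr (- d) - 1"
proof -
  have "\<forall>\<^sub>F c in at_right 0. log 2 (16 * \<gamma> / c) + 2 / d < k * c powr (- d) - 1"
    using assms by real_asymp
  moreover have "\<forall>\<^sub>F c in at_right 0. c \<in> {0<..<D}"
    using assms(4) by (rule eventually_at_right_real)
  ultimately have "\<forall>\<^sub>F c in at_right 0. log 2 (16 * \<gamma> / c) + 2 / d < k * c powr (- d) - 1 \<and> c \<in> {0<..<D}"
    by (rule eventually_conj)
  then obtain c where "log 2 (16 * \<gamma> / c) + 2 / d < k * c powr (- d) - 1" "c \<in> {0<..<D}"
    using eventually_happens[of _ "at_right (0::real)"] by auto
  then show thesis using that by auto
qed

text \<open>Write \<open>L = log 2 N\<close> and take logarithms. The left side is at most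
  \<open>N * L\<close> times the left side of \<open>scale\<close>, while \<open>J\<close> is at
  least \<open>N * L\<close> times \<open>k * c powr (- d)\<close>; the logarithm in
  \<open>\<epsilon>\<close> supplies the factor \<open>L\<close> in \<open>J\<close>.\<close>

lemma packing_scale_bound:
  fixes c d k \<gamma> :: real
  assumes c: "0 < c" "c \<le> 1" and d: "d > 0" and \<gamma>: "\<gamma> \<ge> 1" and N: "N \<ge> 2"
    and scale: "log 2 (16 * \<gamma> / c) + 2 / d < k * c powr (- d) - 1"
    and \<epsilon>: "\<epsilon> = c * (real N * log 2 (real N)) powr (- 1 / d)"
    and J: "k * \<epsilon> powr (- d) \<le> real J"
  shows "(16 * \<gamma> / \<epsilon>) ^ N < 2 ^ (J - 1)"
proof -
  define L where "L = log 2 (real N)"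
  have L: "1 \<le> L" using N by (simp add: L_def)
  have "L \<le> real N" unfolding L_def
    using N less_exp[of N] by (simp add: log_le_iff powr_realpow less_imp_le flip: of_nat_le_iff)
  have NL: "1 \<le> real N * L" using N L mult_mono[of 1 "real N" 1 L] by simp
  have "real N * L \<noteq> 0" using NL by linarith
  then have \<epsilon>_pos: "\<epsilon> > 0" using c by (simp add: \<epsilon> L_def)
  have "\<epsilon> powr (- d) = c powr (- d) * (real N * L)"
    using c d NL L by (simp add: \<epsilon> powr_mult powr_powr flip: L_def)
  then have J': "k * c powr (- d) * (real N * L) \<le> real J" using J by (simp add: mult.assoc)
  have "1 \<le> 16 * \<gamma> / c" using c \<gamma> by (simp add: field_simps)
  then have log_nonneg: "0 \<le> log 2 (16 * \<gamma> / c)" by simp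
  have "16 * \<gamma> / \<epsilon> = 16 * \<gamma> / c * (real N * L) powr (1 / d)"
    by (simp add: \<epsilon> powr_minus_divide flip: L_def)
  also have "log 2 \<dots> = log 2 (16 * \<gamma> / c) + log 2 ((real N * L) powr (1 / d))"
    using c \<gamma> \<open>real N * L \<noteq> 0\<close> by (subst log_mult_pos) auto
  also have "log 2 ((real N * L) powr (1 / d)) = 1 / d * log 2 (real N * L)"
    using \<open>real N * L \<noteq> 0\<close> by (simp add: log_powr)
  finally have log_eq: "log 2 (16 * \<gamma> / \<epsilon>) = log 2 (16 * \<gamma> / c) + 1 / d * log 2 (real N * L)" .
  \<comment> \<open>This follows from \<open>L \<le> real N\<close>. Hence the logarithm of
    \<open>N * L\<close> is at most \<open>2 * L\<close>, the source of \<open>2 / d\<close> in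
    \<open>scale\<close>.\<close>
  have "log 2 L \<le> L"
    using L N \<open>L \<le> real N\<close> unfolding L_def by simp
  then have "log 2 (real N * L) \<le> 2 * L"
    using N L by (subst log_mult_pos) (auto simp: L_def)
  then have "1 / d * log 2 (real N * L) \<le> 1 / d * (2 * L)"
    using d by (intro mult_left_mono) auto
  moreover have "log 2 (16 * \<gamma> / c) * 1 \<le> log 2 (16 * \<gamma> / c) * L"
    using log_nonneg L by (intro mult_left_mono)
  ultimately have "log 2 (16 * \<gamma> / \<epsilon>) \<le> L * (log 2 (16 * \<gamma> / c) + 2 / d)"
    unfolding log_eq by (simp add: algebra_simps)
  then have "real N * log 2 (16 * \<gamma> / \<epsilon>) \<le> (real N * L) * (log 2 (16 * \<gamma> / c) + 2 / d)"
    by (simp add: mult.assoc mult_left_mono)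
  also have "\<dots> < (real N * L) * (k * c powr (- d) - 1)"
    using scale NL by (intro mult_strict_left_mono) auto
  \<comment> \<open>The \<open>- 1\<close> in \<open>scale\<close> is multiplied by
    \<open>real N * L \<ge> 1\<close> and so pays for the lost unit in the exponent.\<close>
  also have "\<dots> \<le> real J - 1" using J' NL by (simp add: algebra_simps)
  finally have less: "real N * log 2 (16 * \<gamma> / \<epsilon>) < real J - 1" .
  \<comment> \<open>Subtraction on naturals is truncated; \<open>1 \<le> J\<close> identifies
    \<open>J - 1\<close> with the real difference.\<close>
  have "1 \<le> J"
  proof (rule ccontr)
    assume "\<not> 1 \<le> J"
    then have "real J = 0" by simp
    then have "k * c powr (- d) \<le> 0"
      using J' NL mult_pos_pos[of "k * c powr (- d)" "real N * L"] by linarith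
    moreover have "0 \<le> 2 / d" using d by simp
    ultimately show False using scale log_nonneg by linarith
  qed
  have "(16 * \<gamma> / \<epsilon>) ^ N = 2 powr (real N * log 2 (16 * \<gamma> / \<epsilon>))"
    using \<gamma> \<epsilon>_pos
    by (subst mult.commute, subst powr_powr[symmetric], subst powr_log_cancel)
      (simp_all add: powr_realpow)
  also have "\<dots> < 2 powr (real J - 1)" using less by simp
  also have "\<dots> = 2 ^ (J - 1)" using \<open>1 \<le> J\<close> by (simp flip: powr_realpow)
  finally show ?thesis .
qed

section \<open>Nodes, constants and the combined estimate\<close>

text \<open>The scale solves \<open>k2 * \<epsilon> powr (- d) = N\<close>, so that a net at this
  scale has at most \<open>N\<close> points.\<close>

lemma ahlfors_exists_nodes:
  fixes M :: "'a::metric_space measure"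
  assumes compact: "compact (UNIV :: 'a set)" and d: "d > 0" and ahlfors: "ahlfors_regular d M"
    and diam_pos: "0 < diameter (UNIV :: 'a set)"
  obtains C where "C > 0"
    "\<And>N. N \<ge> 1 \<Longrightarrow> \<exists>p :: nat \<Rightarrow> 'a. \<forall>x. \<exists>m\<in>{1..N}. dist x (p m) \<le> C * real N powr (- 1 / d)"
proof -
  obtain k1 k2 where k: "0 < k1" "0 < k2"
    and net: "\<And>\<epsilon>. \<lbrakk>0 < \<epsilon>; \<epsilon> \<le> diameter (UNIV :: 'a set)\<rbrakk> \<Longrightarrow>
      \<exists>P :: 'a set. finite P \<and> pairwise (\<lambda>x y. \<epsilon> \<le> dist x y) P \<and> (\<forall>x. \<exists>p\<in>P. dist x p < \<epsilon>) \<and>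
        k1 * \<epsilon> powr (- d) \<le> real (card P) \<and> real (card P) \<le> k2 * \<epsilon> powr (- d)"
    using ahlfors_separated_net[OF compact ahlfors diam_pos] by metis
  show thesis
  proof (rule that[of "k2 powr (1 / d)"])
    show "k2 powr (1 / d) > 0" using k by simp
    fix N :: nat assume N: "N \<ge> 1"
    define \<epsilon> where "\<epsilon> = k2 powr (1 / d) * real N powr (- 1 / d)"
    have \<epsilon>: "\<epsilon> > 0" using k N by (simp add: \<epsilon>_def)
    show "\<exists>p :: nat \<Rightarrow> 'a. \<forall>x. \<exists>m\<in>{1..N}. dist x (p m) \<le> k2 powr (1 / d) * real N powr (- 1 / d)"
    proof (cases "\<epsilon> \<le> diameter (UNIV :: 'a set)")
      case False
      \<comment> \<open>Beyond the diameter the net estimate does not apply, but any single node is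
        within \<open>\<epsilon>\<close> of every point.\<close>
      have "dist x y \<le> \<epsilon>" for x y :: 'a
        using diameter_bounded_bound[OF compact_imp_bounded[OF compact], of x y] False by simp
      then show ?thesis using N by (auto simp: \<epsilon>_def)
    next
      case True
      from net[OF \<epsilon> True] obtain P :: "'a set" where P: "finite P"
        "\<And>x. \<exists>p\<in>P. dist x p < \<epsilon>" "real (card P) \<le> k2 * \<epsilon> powr (- d)" by blast
      have "\<epsilon> powr (- d) = real N / k2"
        using k N d unfolding \<epsilon>_def powr_mult powr_powr by (simp add: powr_minus field_simps)
      then have card: "card P \<le> N" using P(3) k by simp
      obtain h where h: "bij_betw h {0..<card P} P"
        using ex_bij_betw_nat_finite[OF P(1)] by blast
      \<comment> \<open>The enumeration starts at 0, the nodes at 1. Surplus nodes are arbitrary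
        values of \<open>h\<close>, which cannot spoil a net.\<close>
      have "\<exists>m\<in>{1..N}. dist x (h (m - 1)) \<le> \<epsilon>" for x
      proof -
        obtain p where p: "p \<in> P" "dist x p < \<epsilon>" using P(2) by blast
        then have "p \<in> h ` {0..<card P}" using h by (simp add: bij_betw_def)
        then obtain i where "i < card P" "h i = p" by auto
        then show ?thesis using p card by (intro bexI[of _ "Suc i"]) auto
      qed
      then show ?thesis unfolding \<epsilon>_def by (intro exI[of _ "\<lambda>m. h (m - 1)"]) auto
    qed
  qed
qed

text \<open>With \<open>c\<close> chosen before \<open>N\<close>, a separated net at scale
  \<open>\<epsilon>\<close> carries more functions than the packing bound admits, so the width is at
  least \<open>\<epsilon> / 4\<close>.\<close>

lemma lipschitz_width_lip_class_ge:
  fixes M :: "'a::metric_space measure"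
  assumes compact: "compact (UNIV :: 'a set)" and d: "d > 0" and ahlfors: "ahlfors_regular d M"
    and diam_pos: "0 < diameter (UNIV :: 'a set)" and diam: "diameter (UNIV :: 'a set) \<le> 1"
    and \<gamma>: "\<gamma> \<ge> 1"
  obtains c where "c > 0"
    "\<And>N. N \<ge> 2 \<Longrightarrow> ennreal (c * real N powr (- 1 / d) * log 2 (real N) powr (- 1 / d))
      \<le> lipschitz_width N \<gamma> (lip_class :: ('a \<Rightarrow>\<^sub>C real) set)"
proof -
  obtain k1 k2 where k: "0 < k1" "0 < k2"
    and net: "\<And>\<epsilon>. \<lbrakk>0 < \<epsilon>; \<epsilon> \<le> diameter (UNIV :: 'a set)\<rbrakk> \<Longrightarrow>
      \<exists>P :: 'a set. finite P \<and> pairwise (\<lambda>x y. \<epsilon> \<le> dist x y) P \<and> (\<forall>x. \<exists>p\<in>P. dist x p < \<epsilon>) \<and>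
        k1 * \<epsilon> powr (- d) \<le> real (card P) \<and> real (card P) \<le> k2 * \<epsilon> powr (- d)"
    using ahlfors_separated_net[OF compact ahlfors diam_pos] by metis
  obtain c where c: "0 < c" "c \<le> diameter (UNIV :: 'a set)"
    "log 2 (16 * \<gamma> / c) + 2 / d < k1 * c powr (- d) - 1"
    using exists_packing_scale[OF k(1) d _ diam_pos, of \<gamma>] \<gamma> by auto
  show thesis
  proof (rule that[of "c / 4"])
    fix N :: nat assume N: "N \<ge> 2"
    define \<epsilon> where "\<epsilon> = c * (real N * log 2 (real N)) powr (- 1 / d)"
    have log: "1 \<le> log 2 (real N)" using N by simp
    then have NL: "1 \<le> real N * log 2 (real N)"
      using N mult_mono[of 1 "real N" 1 "log 2 (real N)"] by simp
    \<comment> \<open>\<open>s \<le> 1\<close> gives \<open>\<epsilon> \<le> c\<close>, so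
      \<open>\<epsilon>\<close> does not exceed the diameter and the net estimate applies.\<close>
    define s where "s = (real N * log 2 (real N)) powr (- 1 / d)"
    have "s \<le> (real N * log 2 (real N)) powr 0"
      unfolding s_def using NL d by (intro powr_mono) auto
    moreover have "s > 0" unfolding s_def powr_gt_zero using NL by linarith
    ultimately have "0 < s" "s \<le> 1" using NL by (auto split: if_splits)
    moreover have "\<epsilon> = c * s" by (simp add: \<epsilon>_def s_def)
    ultimately have \<epsilon>: "0 < \<epsilon>" "\<epsilon> \<le> c" using c by (auto simp: mult_left_le)
    from net[OF \<epsilon>(1)] \<epsilon> c obtain P :: "'a set" where P: "finite P"
      "pairwise (\<lambda>x y. \<epsilon> \<le> dist x y) P" "\<And>x. \<exists>p\<in>P. dist x p < \<epsilon>" "k1 * \<epsilon> powr (- d) \<le> real (card P)"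
      by (metis order_trans)
    have "P \<noteq> {}" using P(3) by blast
    then obtain F :: "('a \<Rightarrow>\<^sub>C real) set" where F: "finite F" "F \<subseteq> lip_class"
      "pairwise (\<lambda>f g. \<epsilon> \<le> norm (f - g)) F" "card F = 2 ^ (card P - 1)"
      using lip_class_packing[OF compact diam P(1) _ \<epsilon>(1) P(2)] by blast
    have "(16 * \<gamma> / \<epsilon>) ^ N < 2 ^ (card P - 1)"
      using c diam by (intro packing_scale_bound[OF c(1) _ d \<gamma> N c(3) \<epsilon>_def P(4)]) auto
    then have "ennreal (\<epsilon> / 4) \<le> lipschitz_width N \<gamma> (lip_class :: ('a \<Rightarrow>\<^sub>C real) set)"
      using \<epsilon> c diam \<gamma> F(4) by (intro lipschitz_width_ge[OF F(1-3)]) auto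
    moreover have "\<epsilon> / 4 = c / 4 * real N powr (- 1 / d) * log 2 (real N) powr (- 1 / d)"
      using log by (simp add: \<epsilon>_def powr_mult)
    ultimately show "ennreal (c / 4 * real N powr (- 1 / d) * log 2 (real N) powr (- 1 / d))
        \<le> lipschitz_width N \<gamma> (lip_class :: ('a \<Rightarrow>\<^sub>C real) set)" by simp
  qed (use c in simp)
qed

theorem theorem4p8:
  fixes M :: "'a::metric_space measure" and d :: real
  assumes compact: "compact (UNIV :: 'a set)"
    and d_pos: "d > 0"
    and ahlfors: "ahlfors_regular d M"
    and diam: "diameter (UNIV :: 'a set) \<le> 1"
    and nontrivial: "\<exists>x y :: 'a. x \<noteq> y"
  shows "(\<forall>N\<ge>1. \<forall>\<theta> \<in> param_space N. \<forall>\<theta>' \<in> param_space N.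
            norm ((f_hat N \<theta> :: 'a \<Rightarrow>\<^sub>C real) - f_hat N \<theta>') \<le> (1 + sqrt d) * param_dist N \<theta> \<theta>') \<and>
         (\<exists>c C :: real. 0 < c \<and> c \<le> C \<and>
            (\<forall>N::nat. 2 \<le> N \<longrightarrow>
               (\<exists>p :: nat \<Rightarrow> 'a.
                  ennreal (c * real N powr (- 1 / d) * log 2 (real N) powr (- 1 / d))
                    \<le> lipschitz_width N (1 + sqrt d) (lip_class :: ('a \<Rightarrow>\<^sub>C real) set) \<and>
                  lipschitz_width N (1 + sqrt d) (lip_class :: ('a \<Rightarrow>\<^sub>C real) set)
                    \<le> (SUP f\<in>lip_class. ennreal (norm (f - f_hat N (theta_of N p f)))) \<and>
                  (SUP f\<in>lip_class. ennreal (norm (f - f_hat N (theta_of N p f))))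
                    \<le> ennreal (C * real N powr (- 1 / d)))))"
proof (intro conjI allI impI ballI)
  fix N :: nat and \<theta> \<theta>' :: "'a params"
  assume N: "N \<ge> 1" and \<theta>: "\<theta> \<in> param_space N" "\<theta>' \<in> param_space N"
  have "0 \<le> param_dist N \<theta> \<theta>'"
    unfolding param_dist_def by (intro sum_nonneg) (auto simp: case_prod_beta)
  then have "param_dist N \<theta> \<theta>' \<le> (1 + sqrt d) * param_dist N \<theta> \<theta>'"
    using d_pos by (simp add: distrib_right)
  with f_hat_lipschitz[OF compact diam N \<theta>]
  show "norm ((f_hat N \<theta> :: 'a \<Rightarrow>\<^sub>C real) - f_hat N \<theta>') \<le> (1 + sqrt d) * param_dist N \<theta> \<theta>'"
    by linarith
next
  have \<gamma>: "1 + sqrt d \<ge> 1" using d_pos by simp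
  \<comment> \<open>Two distinct points make the diameter positive, so that there are radii to which
    the regularity bounds apply.\<close>
  obtain x y :: 'a where "x \<noteq> y" using nontrivial by blast
  then have "0 < dist x y" by simp
  also have "dist x y \<le> diameter (UNIV :: 'a set)"
    by (rule diameter_bounded_bound[OF compact_imp_bounded[OF compact]]) auto
  finally have diam_pos: "0 < diameter (UNIV :: 'a set)" .
  obtain c where c: "c > 0"
    "\<And>N. N \<ge> 2 \<Longrightarrow> ennreal (c * real N powr (- 1 / d) * log 2 (real N) powr (- 1 / d))
      \<le> lipschitz_width N (1 + sqrt d) (lip_class :: ('a \<Rightarrow>\<^sub>C real) set)"
    using lipschitz_width_lip_class_ge[OF compact d_pos ahlfors diam_pos diam \<gamma>] by metis
  obtain C where C: "C > 0"
    "\<And>N. N \<ge> 1 \<Longrightarrow> \<exists>p :: nat \<Rightarrow> 'a. \<forall>x. \<exists>m\<in>{1..N}. dist x (p m) \<le> C * real N powr (- 1 / d)"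
    using ahlfors_exists_nodes[OF compact d_pos ahlfors diam_pos] by metis
  let ?W = "\<lambda>N. lipschitz_width N (1 + sqrt d) (lip_class :: ('a \<Rightarrow>\<^sub>C real) set)"
  let ?E = "\<lambda>N p. SUP f\<in>lip_class. ennreal (norm ((f :: 'a \<Rightarrow>\<^sub>C real) - f_hat N (theta_of N p f)))"
  \<comment> \<open>\<open>max c C\<close> secures the required order of the two constants.\<close>
  have bounds: "\<exists>p :: nat \<Rightarrow> 'a. ennreal (c * real N powr (- 1 / d) * log 2 (real N) powr (- 1 / d)) \<le> ?W N \<and>
      ?W N \<le> ?E N p \<and> ?E N p \<le> ennreal (max c C * real N powr (- 1 / d))" if N: "2 \<le> N" for N
  proof -
    obtain p :: "nat \<Rightarrow> 'a" where p: "\<And>x. \<exists>m\<in>{1..N}. dist x (p m) \<le> C * real N powr (- 1 / d)"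
      using C(2)[of N] N by auto
    have "?E N p \<le> ennreal (max c C * real N powr (- 1 / d))"
    proof (rule SUP_least, rule ennreal_leI)
      fix f :: "'a \<Rightarrow>\<^sub>C real" assume "f \<in> lip_class"
      then have "norm (f - f_hat N (theta_of N p f)) \<le> C * real N powr (- 1 / d)"
        by (rule norm_f_hat_theta_of_le[OF compact p])
      also have "\<dots> \<le> max c C * real N powr (- 1 / d)" by (intro mult_right_mono) auto
      finally show "norm (f - f_hat N (theta_of N p f)) \<le> max c C * real N powr (- 1 / d)" .
    qed
    moreover have "?W N \<le> ?E N p"
      using N by (intro lipschitz_width_lip_class_le[OF compact _ \<gamma>]) simp
    ultimately show ?thesis using c(2)[OF N] by blast
  qed
  show "\<exists>c C :: real. 0 < c \<and> c \<le> C \<and>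
    (\<forall>N::nat. 2 \<le> N \<longrightarrow>
       (\<exists>p :: nat \<Rightarrow> 'a.
          ennreal (c * real N powr (- 1 / d) * log 2 (real N) powr (- 1 / d)) \<le> ?W N \<and>
          ?W N \<le> ?E N p \<and> ?E N p \<le> ennreal (C * real N powr (- 1 / d))))"
    using c(1) bounds by (intro exI[of _ c] exI[of _ "max c C"]) auto
qed

end
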